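(* Let $\mathcal{B}=(E,\Lambda)$ be a partial linear space. (a) All acyclifiers of $\mathcal{B}$ have the same cardinality, which can hence be denoted by $r^*(\mathcal{B})$. (b) Actually, if $\Lambda=\{\ell_1,\dots,\ell_t\}$, then $r^*(\mathcal{B})=c(\mathcal{B})+\sum_{i=1}^t|\ell_i|-|E|-t$.
   Context: A partial linear space (PLS) is a pair $(E,\Lambda)$ where $E$ is a set (of points) and $\Lambda$ is a set of subsets of $E$ (called lines) such that every line contains at least two points and any two distinct points are contained in at most one common line. In (b), $\ell_1,\dots,\ell_t$ are the $t$ distinct lines of $\mathcal{B}$. Two points are connected if they are equal or are joined by a sequence of points in which any two consecutive points are distinct and lie on a common line; the classes of this equivalence relation determine the connected components of the PLS, and $c(E,\Lambda)$ is their number (isolated points, i.e. points on no line, count as components). A cycle is a sequence $(\ell_1,\dots,\ell_n)$ of $n\ge 3$ distinct lines such that, indices modulo $n$, all $n$ intersections $\ell_i\cap\ell_{i+1}$ are nonempty and pairwise distinct. A PLS is acyclic if it has no cycle. A point-splitting of $(E,\Lambda)$ is a pair $(\ell,p)\in\Lambda\times E$ with $p\in\ell$. Let $PtSp$ be the set of all point-splittings. For $X\subseteq PtSp$ let $X'=\{p^\ell:(\ell,p)\in X\}$ be a set of $|X|$ new distinct points, disjoint from $E$, and for $\ell\in\Lambda$ put $\ell':=(\ell\setminus\{p\in\ell:(\ell,p)\in X\})\cup\{p^\ell:(\ell,p)\in X\}$. Define the PLS $(E,\Lambda)^X:=(E\cup X',\{\ell':\ell\in\Lambda\})$. A set $A\subseteq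 PtSp$ is an acyclifier of $(E,\Lambda)$ if $(E,\Lambda)^A$ is acyclic and has the same number of connected components as $(E,\Lambda)$.
   Formalization: Part (a) assumes finitely many connected components (it fails for infinitely many disjoint two-point lines, which have acyclifiers of sizes 0 and 1); part (b) assumes E is finite, since otherwise the formula subtracts infinite cardinals. *)

theory Defs
  imports Main "HOL-Library.Equipollence"
begin

definition partial_linear_space :: "'a set \<Rightarrow> 'a set set \<Rightarrow> bool" where
  "partial_linear_space E \<Lambda> \<longleftrightarrow>
     (\<forall>l\<in>\<Lambda>. l \<subseteq> E) \<and>
     (\<forall>l\<in>\<Lambda>. \<exists>p\<in>l. \<exists>q\<in>l. p \<noteq> q) \<and>
     (\<forall>p\<in>E. \<forall>q\<in>E. p \<noteq> q \<longrightarrow>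
        (\<forall>l\<in>\<Lambda>. \<forall>m\<in>\<Lambda>. p \<in> l \<and> q \<in> l \<and> p \<in> m \<and> q \<in> m \<longrightarrow> l = m))"

definition collinear_pts :: "'a set set \<Rightarrow> 'a \<Rightarrow> 'a \<Rightarrow> bool" where
  "collinear_pts \<Lambda> p q \<longleftrightarrow> p \<noteq> q \<and> (\<exists>l\<in>\<Lambda>. p \<in> l \<and> q \<in> l)"

definition connected_rel :: "'a set \<Rightarrow> 'a set set \<Rightarrow> ('a \<times> 'a) set" where
  "connected_rel E \<Lambda> = {(p, q). p \<in> E \<and> q \<in> E \<and> (collinear_pts \<Lambda>)\<^sup>*\<^sup>* p q}"

definition pls_components :: "'a set \<Rightarrow> 'a set set \<Rightarrow> 'a set set" where
  "pls_components E \<Lambda> = E // connected_rel E \<Lambda>"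

definition num_components :: "'a set \<Rightarrow> 'a set set \<Rightarrow> nat" where
  "num_components E \<Lambda> = card (pls_components E \<Lambda>)"

definition pls_cycle :: "'a set set \<Rightarrow> 'a set list \<Rightarrow> bool" where
  "pls_cycle \<Lambda> ls \<longleftrightarrow>
     3 \<le> length ls \<and> distinct ls \<and> set ls \<subseteq> \<Lambda> \<and>
     (\<forall>i<length ls. ls ! i \<inter> ls ! (Suc i mod length ls) \<noteq> {}) \<and>
     inj_on (\<lambda>i. ls ! i \<inter> ls ! (Suc i mod length ls)) {..<length ls}"

definition pls_acyclic :: "'a set set \<Rightarrow> bool" where
  "pls_acyclic \<Lambda> \<longleftrightarrow> (\<nexists>ls. pls_cycle \<Lambda> ls)"

definition point_splittings :: "'a set \<Rightarrow> 'a set set \<Rightarrow> ('a set \<times> 'a) set" where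
  "point_splittings E \<Lambda> = {(l, p). l \<in> \<Lambda> \<and> p \<in> E \<and> p \<in> l}"

text \<open>
  The space obtained by carrying out the splittings in \<open>X\<close> lives on a sum type, which keeps the
  new points disjoint from the old ones: \<open>Inl p\<close> is the old point \<open>p\<close>, and \<open>Inr (l, p)\<close> is the
  new point \<open>p\<close>-superscript-\<open>l\<close>.
\<close>

definition split_points :: "'a set \<Rightarrow> ('a set \<times> 'a) set \<Rightarrow> ('a + 'a set \<times> 'a) set" where
  "split_points E X = Inl ` E \<union> Inr ` X"

definition split_line :: "('a set \<times> 'a) set \<Rightarrow> 'a set \<Rightarrow> ('a + 'a set \<times> 'a) set" where
  "split_line X l = Inl ` (l - {p \<in> l. (l, p) \<in> X}) \<union> {Inr (l, p) |p. (l, p) \<in> X}"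

definition split_lines ::
    "'a set set \<Rightarrow> ('a set \<times> 'a) set \<Rightarrow> ('a + 'a set \<times> 'a) set set" where
  "split_lines \<Lambda> X = split_line X ` \<Lambda>"

text \<open>
  Equality of the numbers of components is equality of cardinals, since \<open>E\<close> may be infinite
  and \<^const>\<open>card\<close> does not distinguish infinite sets from the empty set.
\<close>

definition acyclifier :: "'a set \<Rightarrow> 'a set set \<Rightarrow> ('a set \<times> 'a) set \<Rightarrow> bool" where
  "acyclifier E \<Lambda> A \<longleftrightarrow>
     A \<subseteq> point_splittings E \<Lambda> \<and>
     pls_acyclic (split_lines \<Lambda> A) \<and>
     pls_components (split_points E A) (split_lines \<Lambda> A) \<approx> pls_components E \<Lambda>"

text \<open>
  The common cardinality of all acyclifiers, as a natural number; only meant for finite \<open>E\<close>.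
\<close>

definition r_star :: "'a set \<Rightarrow> 'a set set \<Rightarrow> nat" where
  "r_star E \<Lambda> = (THE n. \<exists>A. acyclifier E \<Lambda> A \<and> card A = n)"

end

theory Submission
  imports Defs
begin

text \<open>
  Draw the incidence graph of the space: one vertex for every line and every point, one edge for
  every flag, that is, for every pair \<open>(l, p)\<close> with \<open>p \<in> l\<close>. Point-splittings are exactly the
  edges of this graph, and splitting \<open>(l, p)\<close> replaces the edge between \<open>l\<close> and \<open>p\<close> by a pendant
  edge at \<open>l\<close>. Pendant edges affect neither cycles nor the number of components, so up to them a
  splitting set \<open>A\<close> just deletes the edges in \<open>A\<close>.

  A cycle of lines in the split space is a cycle of the graph of remaining edges. Conversely a
  graph cycle gives a cycle of lines: it has at least three lines, because two distinct lines share
  at most one point. So the split space is acyclic iff the remaining edges form a forest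
  (\<open>pls_acyclic_iff_independent\<close>). The components of the split space correspond to those of the
  remaining graph (\<open>split_pls_components_eqpoll\<close>). Deleting edges can only refine
  connectivity, so if the number of components is finite and does not change, then connectivity does not
  change either. Hence the acyclifiers are the complements of the spanning forests
  (\<open>acyclifier_iff_complement_spanning_forest\<close>), that is, of the bases of the graphic matroid.

  Complements of two bases \<open>B\<close> and \<open>B'\<close> differ by exchanging \<open>B' - B\<close> against \<open>B - B'\<close>, and these
  two sets are equipotent even for infinite \<open>B\<close>, because a point of the closure is already
  spanned by finitely many elements (\<open>bases_differences_eqpoll\<close>). This is the first claim.
  In the finite case a spanning forest, hence an acyclifier, exists. Every edge of a forest joins two
  components of the previous edges, so with \<open>t\<close> lines and \<open>c\<close> components a spanning forest has
  \<open>card E + t - c\<close> edges (\<open>card_forest_plus_components\<close>), out of a total of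
  \<open>\<Sum>i. card (l i)\<close> flags; the difference is the number in the second claim.
\<close>

section \<open>Bases of finitary exchange closures\<close>

unbundle cardinal_syntax

text \<open>
  This is a finitary matroid, given by its closure operator. The second axiom combines monotonicity
  and idempotence.
\<close>
locale exchange_closure =
  fixes cl :: "'e set \<Rightarrow> 'e set"
  assumes extensive: "S \<subseteq> cl S"
    and closed: "S \<subseteq> cl T \<Longrightarrow> cl S \<subseteq> cl T"
    and finitary: "e \<in> cl S \<Longrightarrow> \<exists>S0\<subseteq>S. finite S0 \<and> e \<in> cl S0"
    and exchange: "e \<in> cl (insert f S) \<Longrightarrow> e \<notin> cl S \<Longrightarrow> f \<in> cl (insert e S)"
begin

definition independent :: "'e set \<Rightarrow> bool" where
  "independent S \<longleftrightarrow> (\<forall>e\<in>S. e \<notin> cl (S - {e}))"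

lemma mono: "S \<subseteq> T \<Longrightarrow> cl S \<subseteq> cl T"
  using closed extensive by (meson order_trans)

lemma independent_subset: "independent T \<Longrightarrow> S \<subseteq> T \<Longrightarrow> independent S"
  unfolding independent_def using mono by (meson Diff_mono order_refl subsetD)

lemma independent_insertD:
  "independent (insert e S) \<Longrightarrow> e \<notin> S \<Longrightarrow> e \<notin> cl S"
  unfolding independent_def by (metis Diff_insert_absorb insertI1)

text \<open>
  Steinitz exchange relative to a common part \<open>C\<close>. If some \<open>e \<in> I\<close> really needs the element \<open>d\<close> of the
  spanning set, then \<open>e\<close> can take the place of \<open>d\<close>; moving \<open>e\<close> from \<open>I\<close> into \<open>C\<close> keeps the shape of the
  statement, so the induction can go on.
\<close>
lemma independent_card_le_spanning:
  assumes "finite D" "independent (C \<union> I)" "C \<inter> I = {}" "I \<subseteq> cl (C \<union> D)"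
  shows "finite I \<and> card I \<le> card D"
  using assms
proof (induction D arbitrary: C I rule: finite_induct)
  case empty
  have "I = {}"
  proof (rule ccontr)
    assume "I \<noteq> {}"
    then obtain e where e: "e \<in> I" by blast
    have "e \<in> cl (C \<union> I - {e})"
      using e empty.prems mono[of C "C \<union> I - {e}"] by auto
    then show False
      using e empty.prems(1) unfolding independent_def by blast
  qed
  then show ?case by simp
next
  case (insert d D)
  show ?case
  proof (cases "I \<subseteq> cl (C \<union> D)")
    case True
    then show ?thesis
      using insert.IH[OF insert.prems(1,2)] insert.hyps by (simp add: le_SucI)
  next
    case False
    then obtain e where e: "e \<in> I" "e \<notin> cl (C \<union> D)" by blast
    then have "d \<in> cl (insert e (C \<union> D))"
      using exchange[of e d "C \<union> D"] insert.prems(3) by auto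
    then have "C \<union> insert d D \<subseteq> cl (insert e C \<union> D)"
      using extensive[of "insert e C \<union> D"] by auto
    then have "I - {e} \<subseteq> cl (insert e C \<union> D)"
      using closed insert.prems(3) by blast
    moreover have "independent (insert e C \<union> (I - {e}))"
      using insert.prems(1) e(1) by (metis Un_insert_left Un_insert_right insert_Diff)
    moreover have "insert e C \<inter> (I - {e}) = {}"
      using insert.prems(2) by blast
    ultimately have "finite (I - {e}) \<and> card (I - {e}) \<le> card D"
      using insert.IH by blast
    then show ?thesis
      using e(1) insert.hyps by (auto simp: card_Diff_singleton)
  qed
qed

text \<open>
  Every \<open>d \<in> D\<close> is spanned by finitely many elements of \<open>C \<union> I\<close>. An \<open>e \<in> I\<close> used by no \<open>d\<close> would be
  spanned by the others, through \<open>D\<close>. So \<open>I\<close> is covered by \<open>D\<close>-many finite sets.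
\<close>
lemma independent_lepoll_infinite_spanning:
  assumes "infinite D" "independent (C \<union> I)" "C \<inter> I = {}"
    and I: "I \<subseteq> cl (C \<union> D)" and D: "D \<subseteq> cl (C \<union> I)"
  shows "I \<lesssim> D"
proof -
  have "\<forall>d\<in>D. \<exists>S\<subseteq>C \<union> I. finite S \<and> d \<in> cl S"
    using D finitary by blast
  then obtain S where S: "\<And>d. d \<in> D \<Longrightarrow> S d \<subseteq> C \<union> I \<and> finite (S d) \<and> d \<in> cl (S d)"
    by metis
  have "I \<subseteq> (\<Union>d\<in>D. S d)"
  proof
    fix e assume e: "e \<in> I"
    show "e \<in> (\<Union>d\<in>D. S d)"
    proof (rule ccontr)
      assume "e \<notin> (\<Union>d\<in>D. S d)"
      then have "S d \<subseteq> C \<union> I - {e}" if "d \<in> D" for d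
        using S that by blast
      then have "D \<subseteq> cl (C \<union> I - {e})"
        using S mono by blast
      moreover have "C \<subseteq> cl (C \<union> I - {e})"
        using e assms(3) extensive[of "C \<union> I - {e}"] by auto
      ultimately have "e \<in> cl (C \<union> I - {e})"
        using closed[of "C \<union> D"] I e by blast
      then show False
        using e assms(2) unfolding independent_def by blast
    qed
  qed
  then have "I \<lesssim> (\<Union>d\<in>D. S d)"
    by (rule subset_imp_lepoll)
  also have "(\<Union>d\<in>D. S d) \<lesssim> D"
  proof -
    have "|S d| \<le>o |D|" if "d \<in> D" for d
      using S[OF that] finite_lepoll_infinite[OF assms(1), of "S d"]
      unfolding lepoll_def card_of_ordLeq by simp
    then have "|\<Union>d\<in>D. S d| \<le>o |D|"
      using card_of_UNION_ordLeq_infinite[OF assms(1) ordLeq_refl[OF card_of_Card_order]] by blast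
    then show ?thesis
      unfolding lepoll_def by (simp add: card_of_ordLeq)
  qed
  finally show ?thesis .
qed

lemma independent_lepoll_spanning:
  assumes "independent (C \<union> I)" "C \<inter> I = {}" "I \<subseteq> cl (C \<union> D)" "D \<subseteq> cl (C \<union> I)"
  shows "I \<lesssim> D"
proof (cases "finite D")
  case True
  then show ?thesis
    using independent_card_le_spanning[OF True assms(1-3)] by (simp add: lepoll_iff_card_le)
next
  case False
  then show ?thesis
    using independent_lepoll_infinite_spanning assms by blast
qed

text \<open>
  Relative to \<open>A \<inter> B\<close>, each of the two differences is both independent and spanning, so
  each embeds into the other.
\<close>
proposition bases_differences_eqpoll:
  assumes "independent A" "independent B" "A \<subseteq> cl B" "B \<subseteq> cl A"
  shows "A - B \<approx> B - A"
proof -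
  have *: "X - Y \<lesssim> Y - X" if "independent X" "X \<subseteq> cl Y" "Y \<subseteq> cl X" for X Y
  proof (rule independent_lepoll_spanning[where C = "X \<inter> Y"])
    have "X \<inter> Y \<union> (X - Y) = X" "X \<inter> Y \<union> (Y - X) = Y" by blast+
    then show "independent (X \<inter> Y \<union> (X - Y))" "X - Y \<subseteq> cl (X \<inter> Y \<union> (Y - X))"
      "Y - X \<subseteq> cl (X \<inter> Y \<union> (X - Y))"
      using that by auto
  qed blast
  show ?thesis
    using *[of A B] *[of B A] assms by (simp add: lepoll_antisym)
qed

lemma finite_has_basis:
  assumes "finite S"
  shows "\<exists>B\<subseteq>S. independent B \<and> S \<subseteq> cl B"
  using assms
proof (induction S rule: finite_psubset_induct)
  case (psubset S)
  show ?case
  proof (cases "independent S")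
    case True
    then show ?thesis using extensive by blast
  next
    case False
    then obtain e where e: "e \<in> S" "e \<in> cl (S - {e})"
      unfolding independent_def by blast
    then obtain B where B: "B \<subseteq> S - {e}" "independent B" "S - {e} \<subseteq> cl B"
      using psubset.IH[of "S - {e}"] by blast
    then have "S \<subseteq> cl B"
      using closed[of "S - {e}" B] e by blast
    then show ?thesis
      using B by blast
  qed
qed

end

section \<open>The graphic matroid of an incidence relation\<close>

text \<open>
  A set \<open>F\<close> of pairs of type \<open>'l \<times> 'p\<close> is read as the edge set of a bipartite graph on the
  vertex type \<open>'l + 'p\<close>.
\<close>
definition edge_rel :: "('l \<times> 'p) set \<Rightarrow> ('l + 'p) rel" where
  "edge_rel F = (\<lambda>(l, p). (Inl l, Inr p)) ` F \<union> (\<lambda>(l, p). (Inr p, Inl l)) ` F"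

definition conn :: "('l \<times> 'p) set \<Rightarrow> ('l + 'p) rel" where
  "conn F = (edge_rel F)\<^sup>*"

definition graphic_closure :: "('l \<times> 'p) set \<Rightarrow> ('l \<times> 'p) set" where
  "graphic_closure F = {(l, p). (Inl l, Inr p) \<in> conn F}"

lemma conn_refl [simp]: "(x, x) \<in> conn F"
  by (simp add: conn_def)

lemma conn_trans: "(x, y) \<in> conn F \<Longrightarrow> (y, z) \<in> conn F \<Longrightarrow> (x, z) \<in> conn F"
  unfolding conn_def by (rule rtrancl_trans)

lemma conn_sym: "(x, y) \<in> conn F \<Longrightarrow> (y, x) \<in> conn F"
proof -
  have "sym (edge_rel F)"
    unfolding sym_def edge_rel_def by auto
  then show "(x, y) \<in> conn F \<Longrightarrow> (y, x) \<in> conn F"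
    unfolding conn_def using sym_rtrancl symD by metis
qed

lemma equiv_conn: "equiv UNIV (conn F)"
  by (rule equivI) (auto simp: refl_on_def sym_def trans_def dest: conn_sym conn_trans)

lemma edge_conn: "(l, p) \<in> F \<Longrightarrow> (Inl l, Inr p) \<in> conn F"
  unfolding conn_def edge_rel_def by force

lemma conn_least:
  assumes "equiv UNIV R" "\<And>l p. (l, p) \<in> F \<Longrightarrow> (Inl l, Inr p) \<in> R"
  shows "conn F \<subseteq> R"
proof (rule subrelI)
  fix x y assume xy: "(x, y) \<in> conn F"
  have R: "sym R" "trans R"
    using assms(1) by (auto elim: equivE)
  from xy have "(x, y) \<in> (edge_rel F)\<^sup>*"
    by (simp add: conn_def)
  then show "(x, y) \<in> R"
  proof (induction rule: rtrancl_induct)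
    case base
    then show ?case
      using equiv_class_self[OF assms(1), of x] by simp
  next
    case (step y z)
    from step.hyps(2) obtain l p where "(l, p) \<in> F"
      and "y = Inl l \<and> z = Inr p \<or> y = Inr p \<and> z = Inl l"
      unfolding edge_rel_def by auto
    then have "(y, z) \<in> R"
      using assms(2) symD[OF R(1)] by auto
    then show ?case
      using step.IH transD[OF R(2)] by blast
  qed
qed

lemma conn_mono: "F \<subseteq> G \<Longrightarrow> conn F \<subseteq> conn G"
  by (rule conn_least[OF equiv_conn]) (auto intro: edge_conn)

text \<open>
  A new edge only merges the components of its two ends. Both the exchange property and the
  counting of components rest on this.
\<close>
lemma conn_insert:
  "(x, y) \<in> conn (insert (l, p) F) \<longleftrightarrow>
     (x, y) \<in> conn F \<or> (x, Inl l) \<in> conn F \<and> (Inr p, y) \<in> conn F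
       \<or> (x, Inr p) \<in> conn F \<and> (Inl l, y) \<in> conn F"
    (is "?L \<longleftrightarrow> ?R x y")
proof
  \<comment> \<open>The component that the new edge creates.\<close>
  define M where "M = {z. (z, Inl l) \<in> conn F \<or> (z, Inr p) \<in> conn F}"
  have M: "x \<in> M" if "(x, y) \<in> conn F" "y \<in> M" for x y
    using that conn_trans unfolding M_def by blast
  have "conn (insert (l, p) F) \<subseteq> conn F \<union> M \<times> M"
  proof (rule conn_least)
    show "equiv UNIV (conn F \<union> M \<times> M)"
    proof (rule equivI)
      show "sym (conn F \<union> M \<times> M)"
        by (rule symI) (auto dest: conn_sym)
      show "trans (conn F \<union> M \<times> M)"
        by (rule transI) (auto dest: M conn_sym conn_trans)
    qed (auto simp: refl_on_def)
    show "(Inl m, Inr q) \<in> conn F \<union> M \<times> M" if "(m, q) \<in> insert (l, p) F" for m q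
      using that by (auto simp: edge_conn M_def)
  qed
  moreover have "?R x y" if "x \<in> M" "y \<in> M"
    using that conn_sym[of y] conn_trans[of x] unfolding M_def by blast
  ultimately show "?L \<Longrightarrow> ?R x y" by blast
next
  have F: "conn F \<subseteq> conn (insert (l, p) F)"
    by (rule conn_mono) blast
  have e: "(Inl l, Inr p) \<in> conn (insert (l, p) F)"
    by (simp add: edge_conn)
  show ?L if "?R x y"
    using that F e conn_sym[OF e] conn_trans[of x _ "insert (l, p) F" y]
      conn_trans[of x _ "insert (l, p) F"] by blast
qed

lemma subset_closure_imp_conn_subset: "F \<subseteq> graphic_closure G \<Longrightarrow> conn F \<subseteq> conn G"
  by (rule conn_least[OF equiv_conn]) (auto simp: graphic_closure_def)

text \<open>
  Independent means that every edge is a bridge, so \<open>graphic.independent\<close> singles out the forests.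
\<close>
interpretation graphic: exchange_closure graphic_closure
proof
  show "S \<subseteq> graphic_closure S" for S :: "('l \<times> 'p) set"
    by (auto simp: graphic_closure_def edge_conn)
  show "graphic_closure S \<subseteq> graphic_closure T" if "S \<subseteq> graphic_closure T" for S T :: "('l \<times> 'p) set"
    using subset_closure_imp_conn_subset[OF that] by (auto simp: graphic_closure_def)
  show "f \<in> graphic_closure (insert e S)"
    if "e \<in> graphic_closure (insert f S)" "e \<notin> graphic_closure S" for e f and S :: "('l \<times> 'p) set"
  proof -
    obtain l p m q where "e = (l, p)" "f = (m, q)" by (cases e; cases f)
    then show ?thesis
      using that conn_sym[of "Inl l" "Inl m" S] conn_sym[of "Inr q" "Inr p" S]
        conn_sym[of "Inl l" "Inr q" S] conn_sym[of "Inl m" "Inr p" S]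
      by (simp add: graphic_closure_def conn_insert) blast
  qed
  show "\<exists>S0\<subseteq>S. finite S0 \<and> e \<in> graphic_closure S0"
    if "e \<in> graphic_closure S" for e and S :: "('l \<times> 'p) set"
  proof -
    \<comment> \<open>Being connected by finitely many edges of \<open>S\<close> is itself an equivalence that contains \<open>S\<close>.\<close>
    have "equiv UNIV (\<Union>S0\<in>{S0. S0 \<subseteq> S \<and> finite S0}. conn S0)" (is "equiv UNIV ?R")
    proof (rule equivI)
      show "trans ?R"
      proof (rule transI)
        fix x y z assume "(x, y) \<in> ?R" "(y, z) \<in> ?R"
        then obtain S1 S2 where "S1 \<subseteq> S" "finite S1" "(x, y) \<in> conn S1"
          "S2 \<subseteq> S" "finite S2" "(y, z) \<in> conn S2" by auto
        moreover from this have "(x, z) \<in> conn (S1 \<union> S2)"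
          using conn_mono[of S1 "S1 \<union> S2"] conn_mono[of S2 "S1 \<union> S2"]
          by (blast intro: conn_trans)
        ultimately show "(x, z) \<in> ?R"
          by (intro UN_I[of "S1 \<union> S2"]) auto
      qed
      show "sym ?R"
        by (rule symI) (auto dest: conn_sym)
    qed (auto simp: refl_on_def)
    moreover have "(Inl l, Inr p) \<in> ?R" if "(l, p) \<in> S" for l p
      using that by (intro UN_I[of "{(l, p)}"]) (auto intro: edge_conn)
    ultimately have "conn S \<subseteq> ?R"
      by (rule conn_least)
    then show ?thesis
      using that by (cases e) (auto simp: graphic_closure_def)
  qed
qed

section \<open>Counting the components of a forest\<close>

text \<open>
  The restriction to \<open>V\<close> matters for counting: on the whole type, every vertex outside \<open>V\<close> would be a
  component of its own.
\<close>
definition comp_rel :: "('l + 'p) set \<Rightarrow> ('l \<times> 'p) set \<Rightarrow> ('l + 'p) rel" where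
  "comp_rel V F = conn F \<inter> V \<times> V"

lemma equiv_comp_rel: "equiv V (comp_rel V F)"
  by (rule equivI) (auto simp: comp_rel_def refl_on_def sym_def trans_def dest: conn_sym conn_trans)

lemma card_quotient_merge:
  assumes "finite V" "equiv V R" "u \<in> V" "v \<in> V" "(u, v) \<notin> R"
    and S: "S = R \<union> R `` {u} \<times> R `` {v} \<union> R `` {v} \<times> R `` {u}"
  shows "Suc (card (V // S)) = card (V // R)"
proof -
  let ?U = "R `` {u}" and ?W = "R `` {v}"
  have cls: "S `` {x} = (if x \<in> ?U \<union> ?W then ?U \<union> ?W else R `` {x})" for x
  proof -
    have "R `` {x} = ?U" if "x \<in> ?U"
      using equiv_class_eq[OF assms(2), of u x] that by simp
    moreover have "R `` {x} = ?W" if "x \<in> ?W"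
      using equiv_class_eq[OF assms(2), of v x] that by simp
    moreover have "S `` {x} = R `` {x} \<union> (if x \<in> ?U then ?W else {}) \<union> (if x \<in> ?W then ?U else {})"
      unfolding S by auto
    ultimately show ?thesis
      by (cases "x \<in> ?U"; cases "x \<in> ?W") (simp_all add: Un_commute)
  qed
  have q: "X = ?U \<or> X = ?W" if X: "X \<in> V // R" and meets: "X \<inter> (?U \<union> ?W) \<noteq> {}" for X
  proof -
    obtain y where "y \<in> X" "y \<in> ?U \<or> y \<in> ?W"
      using meets by blast
    then show ?thesis
      using quotient_disj[OF assms(2) X] quotientI[OF assms(3), of R] quotientI[OF assms(4), of R]
      by blast
  qed
  have "V // S = insert (?U \<union> ?W) (V // R - {?U, ?W})"
  proof
    show "V // S \<subseteq> insert (?U \<union> ?W) (V // R - {?U, ?W})"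
    proof
      fix X assume "X \<in> V // S"
      then obtain x where x: "x \<in> V" "X = S `` {x}" by (auto elim: quotientE)
      moreover have "x \<in> R `` {x}"
        using assms(2) x(1) by (rule equiv_class_self)
      ultimately show "X \<in> insert (?U \<union> ?W) (V // R - {?U, ?W})"
        using cls[of x] quotientI[of x V R] by auto
    qed
    show "insert (?U \<union> ?W) (V // R - {?U, ?W}) \<subseteq> V // S"
    proof
      fix X assume "X \<in> insert (?U \<union> ?W) (V // R - {?U, ?W})"
      then consider "X = ?U \<union> ?W" | "X \<in> V // R" "X \<noteq> ?U" "X \<noteq> ?W" by blast
      then show "X \<in> V // S"
      proof cases
        case 1
        then have "X = S `` {u}"
          using cls[of u] equiv_class_self[OF assms(2,3)] by auto
        then show ?thesis
          using assms(3) by (simp add: quotientI)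
      next
        case 2
        then obtain x where x: "x \<in> V" "X = R `` {x}" by (auto elim: quotientE)
        then have "x \<notin> ?U \<union> ?W"
          using q[OF 2(1)] 2(2,3) equiv_class_self[OF assms(2) x(1)] by auto
        then show ?thesis
          using x cls[of x] quotientI[of x V S] by auto
      qed
    qed
  qed
  moreover have "?U \<union> ?W \<notin> V // R - {?U, ?W}"
    using q[of "?U \<union> ?W"] equiv_class_self[OF assms(2,3)] by blast
  moreover have fin: "finite (V // R)"
    using assms(1,2) by (simp add: finite_quotient equiv_type)
  moreover have "card (V // R - {?U, ?W}) = card (V // R) - 2" "2 \<le> card (V // R)"
  proof -
    have sub: "{?U, ?W} \<subseteq> V // R"
      using assms(3,4) by (simp add: quotientI)
    have two: "card {?U, ?W} = 2"
      using assms(5) eq_equiv_class[OF _ assms(2,4)] by (auto simp: card_2_iff)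
    show "card (V // R - {?U, ?W}) = card (V // R) - 2"
      using card_Diff_subset[OF _ sub] two by simp
    show "2 \<le> card (V // R)"
      using card_mono[OF fin sub] two by simp
  qed
  ultimately show ?thesis
    by simp
qed

text \<open>
  Each edge of a forest joins two different components of the edges before it, so it
  lowers their number by exactly one, starting from \<open>card V\<close> isolated vertices.
\<close>
proposition card_forest_plus_components:
  assumes "finite F" "finite V" "graphic.independent F"
    and "\<And>l p. (l, p) \<in> F \<Longrightarrow> Inl l \<in> V \<and> Inr p \<in> V"
  shows "card F + card (V // comp_rel V F) = card V"
  using assms(1,3,4)
proof (induction F rule: finite_induct)
  case empty
  have "conn ({} :: ('a \<times> 'b) set) = Id"
    by (simp add: conn_def edge_rel_def)
  then have "V // comp_rel V {} = (\<lambda>x. {x}) ` V"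
    by (auto simp: quotient_def comp_rel_def)
  then show ?case
    by (simp add: card_image inj_on_def)
next
  case (insert e F)
  obtain l p where e: "e = (l, p)" by (cases e)
  have V: "Inl l \<in> V" "Inr p \<in> V"
    using insert.prems(2) e by auto
  have "(Inl l, Inr p) \<notin> comp_rel V F"
    using graphic.independent_insertD[OF insert.prems(1) insert.hyps(2)]
    by (simp add: e graphic_closure_def comp_rel_def)
  moreover have "comp_rel V (insert e F) = comp_rel V F
      \<union> comp_rel V F `` {Inl l} \<times> comp_rel V F `` {Inr p}
      \<union> comp_rel V F `` {Inr p} \<times> comp_rel V F `` {Inl l}"
    using V conn_sym[of _ "Inl l" F] conn_sym[of "Inl l" _ F]
      conn_sym[of _ "Inr p" F] conn_sym[of "Inr p" _ F]
    by (auto simp: e comp_rel_def conn_insert)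
  ultimately have "Suc (card (V // comp_rel V (insert e F))) = card (V // comp_rel V F)"
    using card_quotient_merge[OF assms(2) equiv_comp_rel] V by blast
  moreover have "card F + card (V // comp_rel V F) = card V"
    using insert.IH insert.prems graphic.independent_subset by blast
  ultimately show ?case
    using insert.hyps by simp
qed

section \<open>Components of a split space and of its incidence graph\<close>

lemma
  assumes "partial_linear_space E \<Lambda>" and l: "l \<in> \<Lambda>"
  shows pls_line_subset: "l \<subseteq> E"
    and pls_line_two_points: "\<exists>p\<in>l. \<exists>q\<in>l. p \<noteq> q"
    and pls_line_nonempty: "l \<noteq> {}"
proof -
  have "\<forall>l\<in>\<Lambda>. l \<subseteq> E"
    using assms(1) unfolding partial_linear_space_def by (elim conjE)
  moreover have "\<forall>l\<in>\<Lambda>. \<exists>p\<in>l. \<exists>q\<in>l. p \<noteq> q"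
    using assms(1) unfolding partial_linear_space_def by (elim conjE)
  ultimately show "l \<subseteq> E" "\<exists>p\<in>l. \<exists>q\<in>l. p \<noteq> q" "l \<noteq> {}"
    using l by auto
qed

lemma quotient_eqpoll:
  assumes "equiv A R" "equiv B S" "f ` A \<subseteq> B"
    and iff: "\<And>x y. x \<in> A \<Longrightarrow> y \<in> A \<Longrightarrow> (x, y) \<in> R \<longleftrightarrow> (f x, f y) \<in> S"
    and onto: "\<And>b. b \<in> B \<Longrightarrow> \<exists>a\<in>A. (f a, b) \<in> S"
  shows "A // R \<approx> B // S"
proof -
  have cls: "S `` f ` (R `` {x}) = S `` {f x}" if "x \<in> A" for x
  proof -
    have "S `` {f y} = S `` {f x}" if "y \<in> R `` {x}" for y
    proof -
      have "y \<in> A"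
        using that equiv_type[OF assms(1)] by blast
      then show ?thesis
        using that \<open>x \<in> A\<close> iff equiv_class_eq[OF assms(2)] by blast
    qed
    then show ?thesis
      using equiv_class_self[OF assms(1) that] by blast
  qed
  have "bij_betw (\<lambda>X. S `` f ` X) (A // R) (B // S)"
  proof (rule bij_betw_imageI)
    show "inj_on (\<lambda>X. S `` f ` X) (A // R)"
    proof (rule inj_onI)
      fix X Y assume X: "X \<in> A // R" and Y: "Y \<in> A // R" and eq: "S `` f ` X = S `` f ` Y"
      obtain x y where x: "x \<in> A" "X = R `` {x}" and y: "y \<in> A" "Y = R `` {y}"
        using X Y by (auto elim!: quotientE)
      then have "S `` {f x} = S `` {f y}"
        using eq cls by simp
      then have "(f x, f y) \<in> S"
        using eq_equiv_class[OF _ assms(2)] assms(3) y by blast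
      then show "X = Y"
        using x y iff equiv_class_eq[OF assms(1)] by blast
    qed
    show "(\<lambda>X. S `` f ` X) ` (A // R) = B // S"
    proof
      show "(\<lambda>X. S `` f ` X) ` (A // R) \<subseteq> B // S"
        using cls assms(3) by (auto elim!: quotientE intro!: quotientI)
      show "B // S \<subseteq> (\<lambda>X. S `` f ` X) ` (A // R)"
      proof
        fix Y assume "Y \<in> B // S"
        then obtain b where b: "b \<in> B" "Y = S `` {b}" by (auto elim!: quotientE)
        obtain a where a: "a \<in> A" "(f a, b) \<in> S"
          using onto[OF b(1)] by blast
        then have "Y = S `` f ` (R `` {a})"
          using b cls equiv_class_eq[OF assms(2)] by simp
        then show "Y \<in> (\<lambda>X. S `` f ` X) ` (A // R)"
          using quotientI[OF a(1)] by (rule image_eqI)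
      qed
    qed
  qed
  then show ?thesis
    unfolding eqpoll_def by blast
qed

text \<open>
  The classes of the coarser relation are images of those of the finer one. With equally many, and
  finitely many, of them, this map is injective: no two finer classes are merged.
\<close>
lemma refinement_eqI:
  assumes "equiv A R" "equiv A S" "R \<subseteq> S" "finite (A // S)" "A // R \<approx> A // S"
  shows "R = S"
proof (rule antisym)
  show "S \<subseteq> R"
  proof (rule subrelI)
    fix x y assume xy: "(x, y) \<in> S"
    then have A: "x \<in> A" "y \<in> A"
      using equiv_type[OF assms(2)] by blast+
    have fin: "finite (A // R)"
      using assms(4,5) eqpoll_finite_iff by blast
    have "inj_on (\<lambda>X. S `` X) (A // R)"
    proof (rule eq_card_imp_inj_on[OF fin])
      show "card ((\<lambda>X. S `` X) ` (A // R)) = card (A // R)"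
        using refines_equiv_image_eq[OF assms(3,1,2)] assms(4,5) fin by (simp add: eqpoll_iff_card)
    qed
    moreover have "S `` (R `` {x}) = S `` (R `` {y})"
      using refines_equiv_class_eq2[OF assms(3,1,2)] equiv_class_eq[OF assms(2) xy] by simp
    ultimately have "R `` {x} = R `` {y}"
      using A by (meson inj_onD quotientI)
    then show "(x, y) \<in> R"
      using eq_equiv_class[OF _ assms(1) A(2)] by blast
  qed
qed fact

lemma equiv_connected_rel: "equiv P (connected_rel P M)"
proof -
  have "symp (collinear_pts M)"
    unfolding collinear_pts_def by (auto intro: sympI)
  then have "symp (collinear_pts M)\<^sup>*\<^sup>*"
    by (rule symp_rtranclp)
  then show ?thesis
    unfolding connected_rel_def
    by (intro equivI) (auto simp: refl_on_def sym_def trans_def dest: sympD)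
qed

lemma collinear_same_line:
  "l \<in> M \<Longrightarrow> x \<in> l \<Longrightarrow> y \<in> l \<Longrightarrow> (collinear_pts M)\<^sup>*\<^sup>* x y"
  by (cases "x = y") (auto simp: collinear_pts_def intro!: r_into_rtranclp)

text \<open>
  The original space and the split spaces are treated at once. The lines of the space are indexed by
  \<open>\<Lambda>\<close>; \<open>pt\<close> embeds the vertices in \<open>E\<close> as points of the space. The map \<open>f\<close> sends each point to a
  vertex of the graph; a point created by splitting has no vertex of its own and goes to
  its line. Then \<open>f\<close> preserves and reflects connectivity and meets every component, as every line
  has a point.
\<close>
lemma pls_components_eqpoll_graph_components:
  assumes F: "F \<subseteq> \<Lambda> \<times> E"
    and line: "\<And>l. l \<in> \<Lambda> \<Longrightarrow> line l \<noteq> {} \<and> line l \<subseteq> P"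
    and pt: "\<And>p. p \<in> E \<Longrightarrow> pt p \<in> P \<and> f (pt p) = Inr p"
    and edge: "\<And>l p. (l, p) \<in> F \<Longrightarrow> pt p \<in> line l"
    and on_line: "\<And>l x. l \<in> \<Lambda> \<Longrightarrow> x \<in> line l \<Longrightarrow> (f x, Inl l) \<in> conn F"
    and cover: "\<And>x. x \<in> P \<Longrightarrow> x \<in> pt ` E \<or> (\<exists>l\<in>\<Lambda>. x \<in> line l \<and> f x = Inl l)"
  shows "pls_components P (line ` \<Lambda>) \<approx> (\<Lambda> <+> E) // comp_rel (\<Lambda> <+> E) F"
proof -
  let ?V = "\<Lambda> <+> E" and ?col = "collinear_pts (line ` \<Lambda>)"
  have V: "f x \<in> ?V" if "x \<in> P" for x
    using cover[OF that] pt by auto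
  have to_conn: "(f x, f y) \<in> conn F" if "?col\<^sup>*\<^sup>* x y" for x y
    using that
  proof (induction rule: rtranclp_induct)
    case (step y z)
    then obtain l where "l \<in> \<Lambda>" "y \<in> line l" "z \<in> line l"
      unfolding collinear_pts_def by blast
    then have "(f y, f z) \<in> conn F"
      using on_line conn_sym conn_trans by blast
    then show ?case
      using step.IH conn_trans by blast
  qed simp
  \<comment> \<open>The points of the space that a vertex stands for: all those of a line, or a single point.\<close>
  define pts_at where "pts_at = case_sum line (\<lambda>p. {pt p})"
  have from_conn: "v \<in> ?V \<and> (\<forall>x\<in>pts_at u. \<forall>y\<in>pts_at v. ?col\<^sup>*\<^sup>* x y)"
    if "(u, v) \<in> conn F" "u \<in> ?V" for u v
    using that unfolding conn_def
  proof (induction rule: rtrancl_induct)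
    case base
    then show ?case
      unfolding pts_at_def using collinear_same_line[OF imageI] by auto
  next
    case (step v w)
    obtain l p where lp: "(l, p) \<in> F" and "v = Inl l \<and> w = Inr p \<or> v = Inr p \<and> w = Inl l"
      using step.hyps(2) unfolding edge_rel_def by auto
    then consider "v = Inl l" "w = Inr p" | "v = Inr p" "w = Inl l" by blast
    then show ?case
    proof cases
      case 1
      then show ?thesis
        using step lp edge F unfolding pts_at_def by auto
    next
      case 2
      have "?col\<^sup>*\<^sup>* (pt p) y" if "y \<in> line l" for y
        using that lp F edge collinear_same_line[OF imageI[of l \<Lambda> line]] by blast
      then show ?thesis
        using 2 step lp F unfolding pts_at_def by (auto intro: rtranclp_trans)
    qed
  qed
  have self: "x \<in> pts_at (f x)" if "x \<in> P" for x
    using cover[OF that] pt unfolding pts_at_def by auto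
  show ?thesis
    unfolding pls_components_def
  proof (rule quotient_eqpoll[OF equiv_connected_rel equiv_comp_rel])
    show "f ` P \<subseteq> ?V"
      using V by blast
    show "(x, y) \<in> connected_rel P (line ` \<Lambda>) \<longleftrightarrow> (f x, f y) \<in> comp_rel ?V F"
      if x: "x \<in> P" and y: "y \<in> P" for x y
    proof -
      have "?col\<^sup>*\<^sup>* x y \<longleftrightarrow> (f x, f y) \<in> conn F"
        using to_conn from_conn[OF _ V[OF x]] self[OF x] self[OF y] by (metis (full_types))
      then show ?thesis
        using x y V by (simp add: connected_rel_def comp_rel_def)
    qed
    show "\<exists>a\<in>P. (f a, b) \<in> comp_rel ?V F" if "b \<in> ?V" for b
      using that
    proof (cases b)
      case (Inl l)
      then have "l \<in> \<Lambda>"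
        using \<open>b \<in> ?V\<close> by auto
      then obtain x where "x \<in> line l" "x \<in> P"
        using line[of l] by blast
      then show ?thesis
        using \<open>l \<in> \<Lambda>\<close> on_line[of l x] V[of x] Inl \<open>b \<in> ?V\<close>
        unfolding comp_rel_def by (intro bexI[of _ x]) simp_all
    next
      case (Inr p)
      then have "p \<in> E"
        using \<open>b \<in> ?V\<close> by auto
      then have "pt p \<in> P" "f (pt p) = b"
        using pt[of p] Inr by simp_all
      then show ?thesis
        using \<open>b \<in> ?V\<close> unfolding comp_rel_def by (intro bexI[of _ "pt p"]) simp_all
    qed
  qed
qed

lemma pls_components_eqpoll:
  assumes "partial_linear_space E \<Lambda>"
  shows "pls_components E \<Lambda> \<approx> (\<Lambda> <+> E) // comp_rel (\<Lambda> <+> E) (point_splittings E \<Lambda>)"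
proof -
  have lines: "l \<noteq> {} \<and> l \<subseteq> E" if "l \<in> \<Lambda>" for l
    using pls_line_nonempty[OF assms that] pls_line_subset[OF assms that] by simp
  have "pls_components E ((\<lambda>l. l) ` \<Lambda>) \<approx> (\<Lambda> <+> E) // comp_rel (\<Lambda> <+> E) (point_splittings E \<Lambda>)"
  proof (rule pls_components_eqpoll_graph_components[where pt = "\<lambda>p. p" and f = Inr])
    fix l x assume "l \<in> \<Lambda>" "x \<in> l"
    then have "(l, x) \<in> point_splittings E \<Lambda>"
      using lines unfolding point_splittings_def by blast
    then show "(Inr x, Inl l) \<in> conn (point_splittings E \<Lambda>)"
      by (rule conn_sym[OF edge_conn])
  next
    show "x \<in> (\<lambda>p. p) ` E \<or> (\<exists>l\<in>\<Lambda>. x \<in> l \<and> Inr x = Inl l)" if "x \<in> E" for x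
      using that by simp
  qed (use lines in \<open>simp_all add: point_splittings_def subset_iff split_beta\<close>)
  then show ?thesis by simp
qed

lemma split_pls_components_eqpoll:
  assumes pls: "partial_linear_space E \<Lambda>" and A: "A \<subseteq> point_splittings E \<Lambda>"
  shows "pls_components (split_points E A) (split_lines \<Lambda> A)
    \<approx> (\<Lambda> <+> E) // comp_rel (\<Lambda> <+> E) (point_splittings E \<Lambda> - A)"
  unfolding split_lines_def
proof -
  have lines: "l \<noteq> {} \<and> l \<subseteq> E" if "l \<in> \<Lambda>" for l
    using pls_line_nonempty[OF pls that] pls_line_subset[OF pls that] by simp
  show "pls_components (split_points E A) (split_line A ` \<Lambda>)
    \<approx> (\<Lambda> <+> E) // comp_rel (\<Lambda> <+> E) (point_splittings E \<Lambda> - A)"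
  proof (rule pls_components_eqpoll_graph_components
      [where pt = Inl and f = "case_sum Inr (\<lambda>(l, p). Inl l)"])
    fix l assume l: "l \<in> \<Lambda>"
    then obtain p where "p \<in> l"
      using lines by blast
    then have "split_line A l \<noteq> {}"
      unfolding split_line_def by (cases "(l, p) \<in> A") auto
    moreover have "split_line A l \<subseteq> split_points E A"
      using l lines unfolding split_line_def split_points_def by auto
    ultimately show "split_line A l \<noteq> {} \<and> split_line A l \<subseteq> split_points E A" by blast
  next
    fix l x assume l: "l \<in> \<Lambda>" and x: "x \<in> split_line A l"
    then consider p where "x = Inl p" "(l, p) \<in> point_splittings E \<Lambda> - A" | p where "x = Inr (l, p)"
      using lines unfolding split_line_def point_splittings_def by auto
    then show "(case_sum Inr (\<lambda>(l, p). Inl l) x, Inl l) \<in> conn (point_splittings E \<Lambda> - A)"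
      by cases (auto intro: conn_sym[OF edge_conn])
  next
    fix x assume "x \<in> split_points E A"
    then consider p where "p \<in> E" "x = Inl p" | l p where "x = Inr (l, p)" "(l, p) \<in> A"
      unfolding split_points_def by auto
    then show "x \<in> Inl ` E \<or> (\<exists>l\<in>\<Lambda>. x \<in> split_line A l \<and> case_sum Inr (\<lambda>(l, p). Inl l) x = Inl l)"
      using A by cases (auto simp: split_line_def point_splittings_def)
  qed (auto simp: point_splittings_def split_points_def split_line_def)
qed

section \<open>Cycles of lines and cycles of the incidence graph\<close>

text \<open>
  A cycle \<open>L 0, P 0, L 1, P 1, \<dots>, L (n - 1), P (n - 1)\<close> of length \<open>2 * n\<close> in the bipartite graph.
\<close>
definition incidence_cycle :: "('l \<times> 'p) set \<Rightarrow> nat \<Rightarrow> (nat \<Rightarrow> 'l) \<Rightarrow> (nat \<Rightarrow> 'p) \<Rightarrow> bool" where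
  "incidence_cycle F n L P \<longleftrightarrow> 3 \<le> n \<and> inj_on L {..<n} \<and> inj_on P {..<n} \<and>
     (\<forall>i<n. (L i, P i) \<in> F \<and> (L (Suc i mod n), P i) \<in> F)"

text \<open>
  Absence of graph cycles of length four, which would not come from cycles of lines.
\<close>
definition linear_incidence :: "('l \<times> 'p) set \<Rightarrow> bool" where
  "linear_incidence F \<longleftrightarrow> (\<forall>l m p q. (l, p) \<in> F \<and> (m, p) \<in> F \<and> (l, q) \<in> F \<and> (m, q) \<in> F
     \<longrightarrow> l = m \<or> p = q)"

text \<open>
  The rest of the cycle joins the two ends of the edge between \<open>L 0\<close> and \<open>P 0\<close>.
\<close>
lemma incidence_cycle_imp_dependent:
  assumes "incidence_cycle F n L P"
  shows "\<not> graphic.independent F"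
proof -
  have n: "3 \<le> n" and L: "inj_on L {..<n}" and P: "inj_on P {..<n}"
    and e: "\<And>i. i < n \<Longrightarrow> (L i, P i) \<in> F" "\<And>i. i < n \<Longrightarrow> (L (Suc i mod n), P i) \<in> F"
    using assms unfolding incidence_cycle_def by blast+
  let ?S = "F - {(L 0, P 0)}"
  have L0: "L i \<noteq> L 0" if "0 < i" "i < n" for i
    using inj_onD[OF L, of i 0] that by auto
  have "(Inl (L 1), Inl (L j)) \<in> conn ?S" if "1 \<le> j" "j < n" for j
    using that
  proof (induction j rule: dec_induct)
    case (step j)
    have "(L j, P j) \<in> ?S" "(L (Suc j), P j) \<in> ?S"
      using e[of j] L0[of j] L0[of "Suc j"] step by auto
    then have "(Inl (L j), Inl (L (Suc j))) \<in> conn ?S"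
      by (rule conn_trans[OF edge_conn conn_sym[OF edge_conn]])
    then show ?case
      using step.IH step.prems conn_trans by fastforce
  qed simp
  then have around: "(Inl (L 1), Inl (L (n - 1))) \<in> conn ?S"
    using n by simp
  have L1: "(L 1, P 0) \<in> ?S"
    using e(2)[of 0] L0[of 1] n by auto
  have "(L (n - 1), P (n - 1)) \<in> ?S"
    using e(1)[of "n - 1"] L0[of "n - 1"] n by auto
  moreover have "(L 0, P (n - 1)) \<in> ?S"
    using e(2)[of "n - 1"] inj_onD[OF P, of "n - 1" 0] n by auto
  ultimately have "(Inl (L 0), Inl (L (n - 1))) \<in> conn ?S"
    using conn_trans[OF edge_conn conn_sym[OF edge_conn]] by metis
  then have "(Inl (L 0), Inr (P 0)) \<in> conn ?S"
    using conn_trans[OF conn_trans[OF _ conn_sym[OF around]] edge_conn[OF L1]] by simp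
  then have "(L 0, P 0) \<in> graphic_closure ?S"
    by (simp add: graphic_closure_def)
  then show ?thesis
    using e(1)[of 0] n unfolding graphic.independent_def by force
qed

text \<open>
  Some edge \<open>(l, p)\<close> has its ends joined by other edges. Among all sequences of lines that
  start in \<open>l\<close>, end in a line through \<open>p\<close> and have consecutive lines meeting, take a shortest one.
  A repeated line or a repeated meeting point would allow a shortcut, so \<open>(l, p)\<close> closes it to a cycle.
\<close>
lemma dependent_imp_incidence_cycle:
  assumes lin: "linear_incidence F" and dep: "\<not> graphic.independent F"
  obtains n L P where "incidence_cycle F n L P"
proof -
  obtain l p where lp: "(l, p) \<in> F" and conn: "(Inl l, Inr p) \<in> conn (F - {(l, p)})"
    using dep unfolding graphic.independent_def graphic_closure_def by auto
  define S where "S = F - {(l, p)}"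
  define adj where "adj = {(k, m). k \<noteq> m \<and> (\<exists>q. (k, q) \<in> S \<and> (m, q) \<in> S)}"
  have walk: "case v of Inl m \<Rightarrow> (l, m) \<in> adj\<^sup>* | Inr q \<Rightarrow> \<exists>m. (l, m) \<in> adj\<^sup>* \<and> (m, q) \<in> S"
    if "(Inl l, v) \<in> conn S" for v
    using that unfolding conn_def
  proof (induction rule: rtrancl_induct)
    case (step v w)
    obtain m q where mq: "(m, q) \<in> S" and "v = Inl m \<and> w = Inr q \<or> v = Inr q \<and> w = Inl m"
      using step.hyps(2) unfolding edge_rel_def by auto
    then consider "v = Inl m" "w = Inr q" | "v = Inr q" "w = Inl m" by blast
    then show ?case
    proof cases
      case 1
      then show ?thesis using step.IH mq by auto
    next
      case 2
      then obtain k where k: "(l, k) \<in> adj\<^sup>*" "(k, q) \<in> S" using step.IH by auto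
      then have "k = m \<or> (k, m) \<in> adj"
        using mq unfolding adj_def by blast
      then show ?thesis
        using 2 k(1) by (auto intro: rtrancl_into_rtrancl)
    qed
  qed simp
  define reaches where "reaches n \<longleftrightarrow> (\<exists>m. (l, m) \<in> adj ^^ n \<and> (m, p) \<in> S)" for n
  have "\<exists>n. reaches n"
    using walk[of "Inr p"] conn rtrancl_imp_relpow unfolding reaches_def S_def by fastforce
  then obtain n where n: "reaches n" and least: "\<And>k. reaches k \<Longrightarrow> n \<le> k"
    by (metis LeastI_ex Least_le)
  then obtain m where "(l, m) \<in> adj ^^ n" and mp: "(m, p) \<in> S"
    unfolding reaches_def by blast
  then obtain L where L0: "L 0 = l" and Ln: "L n = m"
    and step: "\<And>i. i < n \<Longrightarrow> (L i, L (Suc i)) \<in> adj"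
    unfolding relpow_fun_conv by blast
  have sub: "(L i, L (i + k)) \<in> adj ^^ k" if "i + k \<le> n" for i k
    using that
  proof (induction k)
    case (Suc k)
    then show ?case
      using relpow_Suc_I[of "L i" "L (i + k)" k adj] step[of "i + k"] by simp
  qed simp
  \<comment> \<open>By minimality no line of the sequence can be reached from \<open>l\<close> in fewer steps.\<close>
  have dist: "j \<le> k" if "j \<le> n" "(l, L j) \<in> adj ^^ k" for j k
  proof -
    have "(l, m) \<in> adj ^^ (k + (n - j))"
      unfolding relpow_add using that sub[of j "n - j"] Ln by auto
    then show ?thesis
      using least[of "k + (n - j)"] mp that(1) unfolding reaches_def by fastforce
  qed
  have from_l: "(l, L i) \<in> adj ^^ i" if "i \<le> n" for i
    using sub[of 0 i] that L0 by simp
  have L_neq: "L i \<noteq> L j" if "i < j" "j \<le> n" for i j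
    using dist[of j i] from_l[of i] that by auto
  have "\<forall>i<n. \<exists>q. (L i, q) \<in> S \<and> (L (Suc i), q) \<in> S"
    using step unfolding adj_def by blast
  then obtain Q where Q: "\<And>i. i < n \<Longrightarrow> (L i, Q i) \<in> S \<and> (L (Suc i), Q i) \<in> S"
    by metis
  have Q_neq: "Q i \<noteq> Q j" if "i < j" "j < n" for i j
  proof
    assume "Q i = Q j"
    then have "(L i, L (Suc j)) \<in> adj"
      using Q[of i] Q[of j] L_neq[of i "Suc j"] that unfolding adj_def by auto
    then have "(l, L (Suc j)) \<in> adj ^^ Suc i"
      using from_l[of i] that by (auto intro: relpow_Suc_I)
    then show False
      using dist[of "Suc j" "Suc i"] that by simp
  qed
  have Q_p: "Q i \<noteq> p" if "i < n" for i
    using least[of i] from_l[of i] Q[OF that] that unfolding reaches_def by fastforce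
  \<comment> \<open>With \<open>n = 1\<close> the distinct lines \<open>l\<close> and \<open>m\<close> would share both \<open>Q 0\<close> and \<open>p\<close>.\<close>
  have "2 \<le> n"
  proof (rule ccontr)
    assume "\<not> 2 \<le> n"
    then consider "n = 0" | "n = 1" by linarith
    then show False
    proof cases
      case 1
      then show ?thesis
        using L0 Ln mp unfolding S_def by auto
    next
      case 2
      then have "(l, Q 0) \<in> F" "(m, Q 0) \<in> F" "(m, p) \<in> F" "l \<noteq> m" "Q 0 \<noteq> p"
        using Q[of 0] Q_p[of 0] L_neq[of 0 1] L0 Ln mp unfolding S_def by auto
      then show ?thesis
        using lin lp unfolding linear_incidence_def by blast
    qed
  qed
  define P where "P i = (if i < n then Q i else p)" for i
  have "incidence_cycle F (Suc n) L P"
    unfolding incidence_cycle_def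
  proof (intro conjI allI impI)
    show "3 \<le> Suc n"
      using \<open>2 \<le> n\<close> by simp
    show "inj_on L {..<Suc n}"
      by (rule linorder_inj_onI) (use L_neq in auto)
    show "inj_on P {..<Suc n}"
    proof (rule linorder_inj_onI)
      fix i j assume "i < j" "i \<in> {..<Suc n}" "j \<in> {..<Suc n}"
      then show "P i \<noteq> P j"
        using Q_neq[of i j] Q_p[of i] unfolding P_def by auto
    qed auto
    fix i assume "i < Suc n"
    then consider "i < n" | "i = n" by linarith
    then have "(L i, P i) \<in> F \<and> (L (Suc i mod Suc n), P i) \<in> F"
    proof cases
      case 1
      then show ?thesis using Q[of i] unfolding P_def S_def by auto
    next
      case 2
      then show ?thesis using mp Ln L0 lp unfolding P_def S_def by auto
    qed
    then show "(L i, P i) \<in> F" "(L (Suc i mod Suc n), P i) \<in> F" by auto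
  qed
  then show ?thesis by (rule that)
qed

lemma linear_incidence_point_splittings:
  assumes "partial_linear_space E \<Lambda>"
  shows "linear_incidence (point_splittings E \<Lambda>)"
  unfolding linear_incidence_def
proof (intro allI impI)
  fix l m p q
  assume "(l, p) \<in> point_splittings E \<Lambda> \<and> (m, p) \<in> point_splittings E \<Lambda> \<and>
    (l, q) \<in> point_splittings E \<Lambda> \<and> (m, q) \<in> point_splittings E \<Lambda>"
  then have "l \<in> \<Lambda>" "m \<in> \<Lambda>" "p \<in> E" "q \<in> E" "p \<in> l \<and> q \<in> l \<and> p \<in> m \<and> q \<in> m"
    unfolding point_splittings_def by auto
  moreover have "\<forall>p\<in>E. \<forall>q\<in>E. p \<noteq> q \<longrightarrow>
      (\<forall>l\<in>\<Lambda>. \<forall>m\<in>\<Lambda>. p \<in> l \<and> q \<in> l \<and> p \<in> m \<and> q \<in> m \<longrightarrow> l = m)"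
    using assms unfolding partial_linear_space_def by (elim conjE)
  ultimately show "l = m \<or> p = q"
    by metis
qed

lemma linear_incidence_subset: "linear_incidence G \<Longrightarrow> F \<subseteq> G \<Longrightarrow> linear_incidence F"
  unfolding linear_incidence_def by blast

text \<open>
  A new point lies only on the line at which it was split off, so lines meet only where neither has
  been split.
\<close>
lemma split_lines_meet_in_old_point:
  assumes "partial_linear_space E \<Lambda>" "k \<in> \<Lambda>" "m \<in> \<Lambda>" "k \<noteq> m"
    and "x \<in> split_line A k" "x \<in> split_line A m"
  obtains p where "x = Inl p" "(k, p) \<in> point_splittings E \<Lambda> - A" "(m, p) \<in> point_splittings E \<Lambda> - A"
  using assms(2-) pls_line_subset[OF assms(1,2)]
  unfolding split_line_def point_splittings_def by auto

lemma old_point_in_split_line: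
  "(l, p) \<in> point_splittings E \<Lambda> - A \<Longrightarrow> Inl p \<in> split_line A l"
  unfolding split_line_def point_splittings_def by auto

lemma split_line_Int:
  assumes "partial_linear_space E \<Lambda>" "k \<in> \<Lambda>" "m \<in> \<Lambda>" "k \<noteq> m"
    and "(k, p) \<in> point_splittings E \<Lambda> - A" "(m, p) \<in> point_splittings E \<Lambda> - A"
  shows "split_line A k \<inter> split_line A m = {Inl p}"
proof
  show "split_line A k \<inter> split_line A m \<subseteq> {Inl p}"
  proof
    fix x assume "x \<in> split_line A k \<inter> split_line A m"
    then obtain q where q: "x = Inl q" "(k, q) \<in> point_splittings E \<Lambda> - A"
      "(m, q) \<in> point_splittings E \<Lambda> - A"
      using split_lines_meet_in_old_point[OF assms(1-4)] by blast
    then have "q = p"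
      using linear_incidence_point_splittings[OF assms(1)] assms(4-6)
      unfolding linear_incidence_def by blast
    then show "x \<in> {Inl p}"
      using q by simp
  qed
  show "{Inl p} \<subseteq> split_line A k \<inter> split_line A m"
    using old_point_in_split_line assms(5,6) by fastforce
qed

text \<open>
  Splitting never identifies lines: if the split versions of distinct lines were equal, every
  point of the one line would be a common point of both, but a line has at least two points.
\<close>
lemma inj_on_split_line:
  assumes "partial_linear_space E \<Lambda>"
  shows "inj_on (split_line A) \<Lambda>"
proof (rule inj_onI, rule ccontr)
  fix k m assume km: "k \<in> \<Lambda>" "m \<in> \<Lambda>" "split_line A k = split_line A m" "k \<noteq> m"
  obtain p q where pq: "p \<in> k" "q \<in> k" "p \<noteq> q"
    using pls_line_two_points[OF assms km(1)] by blast
  have flags: "(k, r) \<in> point_splittings E \<Lambda> \<and> (m, r) \<in> point_splittings E \<Lambda>" if r: "r \<in> k" for r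
  proof -
    let ?x = "if (k, r) \<in> A then Inr (k, r) else Inl r"
    have "?x \<in> split_line A k"
      using r unfolding split_line_def by auto
    then obtain s where "?x = Inl s" "(k, s) \<in> point_splittings E \<Lambda> - A"
      "(m, s) \<in> point_splittings E \<Lambda> - A"
      using split_lines_meet_in_old_point[OF assms km(1,2,4)] km(3) by metis
    then show ?thesis by (auto split: if_splits)
  qed
  show False
    using linear_incidence_point_splittings[OF assms] flags[OF pq(1)] flags[OF pq(2)] pq(3) km(4)
    unfolding linear_incidence_def by blast
qed

lemma Suc_mod_neq: "i < n \<Longrightarrow> 2 \<le> n \<Longrightarrow> Suc i mod n \<noteq> i"
  by (cases "Suc i = n") auto

text \<open>
  Consecutive lines of a cycle meet in exactly one point, an old one. Hence the condition that the
  intersections are pairwise distinct says that these points are, as a graph cycle requires.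
\<close>
lemma pls_cycle_iff_incidence_cycle:
  assumes pls: "partial_linear_space E \<Lambda>"
  shows "(\<exists>ls. pls_cycle (split_lines \<Lambda> A) ls) \<longleftrightarrow>
    (\<exists>n L P. incidence_cycle (point_splittings E \<Lambda> - A) n L P)"
proof
  assume "\<exists>ls. pls_cycle (split_lines \<Lambda> A) ls"
  then obtain ls where ls: "pls_cycle (split_lines \<Lambda> A) ls" ..
  define n where "n = length ls"
  have n: "3 \<le> n" "distinct ls"
    and meet: "\<And>i. i < n \<Longrightarrow> ls ! i \<inter> ls ! (Suc i mod n) \<noteq> {}"
    and inj: "inj_on (\<lambda>i. ls ! i \<inter> ls ! (Suc i mod n)) {..<n}"
    using ls unfolding pls_cycle_def n_def by auto
  have "\<forall>i<n. \<exists>l\<in>\<Lambda>. ls ! i = split_line A l"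
    using ls nth_mem unfolding pls_cycle_def split_lines_def n_def by blast
  then obtain L where L: "\<And>i. i < n \<Longrightarrow> L i \<in> \<Lambda> \<and> ls ! i = split_line A (L i)"
    by metis
  have injL: "inj_on L {..<n}"
  proof (rule inj_onI)
    fix i j assume "i \<in> {..<n}" "j \<in> {..<n}" "L i = L j"
    then show "i = j"
      using L n(2) nth_eq_iff_index_eq[of ls i j] unfolding n_def by auto
  qed
  have next_i: "Suc i mod n < n" "L i \<noteq> L (Suc i mod n)" if "i < n" for i
  proof -
    show "Suc i mod n < n"
      using n(1) by simp
    then show "L i \<noteq> L (Suc i mod n)"
      using inj_onD[OF injL, of i "Suc i mod n"] Suc_mod_neq[of i n] n(1) that by auto
  qed
  have "\<exists>p. (L i, p) \<in> point_splittings E \<Lambda> - A \<and> (L (Suc i mod n), p) \<in> point_splittings E \<Lambda> - A"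
    if i: "i < n" for i
  proof -
    obtain x where "x \<in> split_line A (L i)" "x \<in> split_line A (L (Suc i mod n))"
      using meet[OF i] L[OF i] L[OF next_i(1)[OF i]] by auto
    then show ?thesis
      using split_lines_meet_in_old_point[OF pls _ _ next_i(2)[OF i]] L[OF i] L[OF next_i(1)[OF i]]
      by metis
  qed
  then obtain P where P: "\<And>i. i < n \<Longrightarrow> (L i, P i) \<in> point_splittings E \<Lambda> - A
      \<and> (L (Suc i mod n), P i) \<in> point_splittings E \<Lambda> - A"
    by metis
  have int: "ls ! i \<inter> ls ! (Suc i mod n) = {Inl (P i)}" if "i < n" for i
    using split_line_Int[OF pls _ _ next_i(2)[OF that]] P[OF that] L[OF that] L[OF next_i(1)[OF that]]
    by simp
  have "inj_on P {..<n}"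
  proof (rule inj_onI)
    fix i j assume "i \<in> {..<n}" "j \<in> {..<n}" "P i = P j"
    then show "i = j"
      using inj_onD[OF inj, of i j] int by simp
  qed
  then show "\<exists>n L P. incidence_cycle (point_splittings E \<Lambda> - A) n L P"
    using n(1) injL P unfolding incidence_cycle_def by blast
next
  assume "\<exists>n L P. incidence_cycle (point_splittings E \<Lambda> - A) n L P"
  then obtain n L P where n: "3 \<le> n" and injL: "inj_on L {..<n}" and injP: "inj_on P {..<n}"
    and P: "\<And>i. i < n \<Longrightarrow> (L i, P i) \<in> point_splittings E \<Lambda> - A
      \<and> (L (Suc i mod n), P i) \<in> point_splittings E \<Lambda> - A"
    unfolding incidence_cycle_def by blast
  have L: "L i \<in> \<Lambda>" if "i < n" for i
    using P[OF that] unfolding point_splittings_def by auto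
  define ls where "ls = map (\<lambda>i. split_line A (L i)) [0..<n]"
  have nth: "ls ! i = split_line A (L i)" if "i < n" for i
    using that unfolding ls_def by simp
  have int: "ls ! i \<inter> ls ! (Suc i mod n) = {Inl (P i)}" if "i < n" for i
  proof -
    have m: "Suc i mod n < n"
      using n by simp
    then have "L i \<noteq> L (Suc i mod n)"
      using inj_onD[OF injL, of i "Suc i mod n"] Suc_mod_neq[of i n] n that by auto
    then show ?thesis
      using split_line_Int[OF pls] P[OF that] L[OF that] L[OF m] nth[OF that] nth[OF m] by simp
  qed
  have "inj_on (\<lambda>i. split_line A (L i)) {..<n}"
  proof (rule inj_onI)
    fix i j assume ij: "i \<in> {..<n}" "j \<in> {..<n}" "split_line A (L i) = split_line A (L j)"
    then have "L i = L j"
      using inj_onD[OF inj_on_split_line[OF pls] ij(3)] L by simp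
    then show "i = j"
      using inj_onD[OF injL] ij by simp
  qed
  then have "distinct ls"
    unfolding ls_def by (simp add: distinct_map atLeast0LessThan)
  moreover have "set ls \<subseteq> split_lines \<Lambda> A"
    using L unfolding ls_def split_lines_def by auto
  moreover have "inj_on (\<lambda>i. ls ! i \<inter> ls ! (Suc i mod n)) {..<n}"
  proof (rule inj_onI)
    fix i j assume ij: "i \<in> {..<n}" "j \<in> {..<n}"
      and "ls ! i \<inter> ls ! (Suc i mod n) = ls ! j \<inter> ls ! (Suc j mod n)"
    then have "P i = P j"
      using int by simp
    then show "i = j"
      using inj_onD[OF injP] ij by simp
  qed
  moreover have "length ls = n"
    unfolding ls_def by simp
  ultimately have "pls_cycle (split_lines \<Lambda> A) ls"
    using n int unfolding pls_cycle_def by simp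
  then show "\<exists>ls. pls_cycle (split_lines \<Lambda> A) ls" ..
qed

proposition pls_acyclic_iff_independent:
  assumes "partial_linear_space E \<Lambda>"
  shows "pls_acyclic (split_lines \<Lambda> A) \<longleftrightarrow> graphic.independent (point_splittings E \<Lambda> - A)"
proof -
  have "linear_incidence (point_splittings E \<Lambda> - A)"
    using linear_incidence_subset[OF linear_incidence_point_splittings[OF assms]] by blast
  then show ?thesis
    unfolding pls_acyclic_def pls_cycle_iff_incidence_cycle[OF assms]
    using incidence_cycle_imp_dependent dependent_imp_incidence_cycle by blast
qed

section \<open>Acyclifiers as complements of spanning forests\<close>

lemma spanning_imp_comp_rel_eq:
  assumes "F \<subseteq> G" "G \<subseteq> graphic_closure F"
  shows "comp_rel V F = comp_rel V G"
  using conn_mono[OF assms(1)] subset_closure_imp_conn_subset[OF assms(2)] unfolding comp_rel_def by blast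

text \<open>
  The equality of two component counts turns into the equality of two connectivity relations because
  one of them refines the other and the count is finite.
\<close>
proposition acyclifier_iff_complement_spanning_forest:
  assumes pls: "partial_linear_space E \<Lambda>" and fin: "finite (pls_components E \<Lambda>)"
  shows "acyclifier E \<Lambda> A \<longleftrightarrow> A \<subseteq> point_splittings E \<Lambda> \<and>
    graphic.independent (point_splittings E \<Lambda> - A) \<and>
    point_splittings E \<Lambda> \<subseteq> graphic_closure (point_splittings E \<Lambda> - A)"
proof -
  let ?I = "point_splittings E \<Lambda>" and ?V = "\<Lambda> <+> E"
  note orig = pls_components_eqpoll[OF pls]
  have "pls_components (split_points E A) (split_lines \<Lambda> A) \<approx> pls_components E \<Lambda>
      \<longleftrightarrow> ?I \<subseteq> graphic_closure (?I - A)"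
    if A: "A \<subseteq> ?I"
  proof -
    have "pls_components (split_points E A) (split_lines \<Lambda> A) \<approx> pls_components E \<Lambda> \<longleftrightarrow>
        ?V // comp_rel ?V (?I - A) \<approx> ?V // comp_rel ?V ?I"
      using orig split_pls_components_eqpoll[OF pls A] by (meson eqpoll_sym eqpoll_trans)
    also have "\<dots> \<longleftrightarrow> ?I \<subseteq> graphic_closure (?I - A)"
    proof
      assume eqp: "?V // comp_rel ?V (?I - A) \<approx> ?V // comp_rel ?V ?I"
      have "comp_rel ?V (?I - A) \<subseteq> comp_rel ?V ?I"
        using conn_mono[of "?I - A" ?I] unfolding comp_rel_def by blast
      moreover have "finite (?V // comp_rel ?V ?I)"
        using orig fin eqpoll_finite_iff by blast
      ultimately have eq: "comp_rel ?V (?I - A) = comp_rel ?V ?I"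
        using refinement_eqI[OF equiv_comp_rel equiv_comp_rel] eqp by blast
      show "?I \<subseteq> graphic_closure (?I - A)"
      proof
        fix e assume e: "e \<in> ?I"
        then obtain l p where lp: "e = (l, p)" "l \<in> \<Lambda>" "p \<in> E"
          unfolding point_splittings_def by auto
        then have "(Inl l, Inr p) \<in> comp_rel ?V ?I"
          using e edge_conn unfolding comp_rel_def by fastforce
        then show "e \<in> graphic_closure (?I - A)"
          unfolding eq[symmetric] by (simp add: lp(1) comp_rel_def graphic_closure_def)
      qed
    next
      assume "?I \<subseteq> graphic_closure (?I - A)"
      then show "?V // comp_rel ?V (?I - A) \<approx> ?V // comp_rel ?V ?I"
        using spanning_imp_comp_rel_eq[of "?I - A" ?I] by simp
    qed
    finally show ?thesis .
  qed
  then show ?thesis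
    unfolding acyclifier_def pls_acyclic_iff_independent[OF pls] by blast
qed

text \<open>
  Taking complements in the set of flags swaps the two differences: \<open>A - B\<close> is
  what the spanning forest for \<open>B\<close> has and that for \<open>A\<close> lacks.
\<close>
proposition acyclifiers_eqpoll:
  assumes pls: "partial_linear_space E \<Lambda>" and fin: "finite (pls_components E \<Lambda>)"
    and "acyclifier E \<Lambda> A" "acyclifier E \<Lambda> B"
  shows "A \<approx> B"
proof -
  let ?I = "point_splittings E \<Lambda>"
  have A: "A \<subseteq> ?I" "graphic.independent (?I - A)" "?I \<subseteq> graphic_closure (?I - A)"
    and B: "B \<subseteq> ?I" "graphic.independent (?I - B)" "?I \<subseteq> graphic_closure (?I - B)"
    using assms(3,4) unfolding acyclifier_iff_complement_spanning_forest[OF pls fin] by auto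
  have "(?I - B) - (?I - A) \<approx> (?I - A) - (?I - B)"
    by (rule graphic.bases_differences_eqpoll) (use A B in auto)
  moreover have "(?I - B) - (?I - A) = A - B" "(?I - A) - (?I - B) = B - A"
    using A(1) B(1) by auto
  ultimately have "A - B \<approx> B - A" by simp
  then have "(A \<inter> B) \<union> (A - B) \<approx> (A \<inter> B) \<union> (B - A)"
    by (intro Un_eqpoll_cong) (auto simp: disjnt_def)
  moreover have "(A \<inter> B) \<union> (A - B) = A" "(A \<inter> B) \<union> (B - A) = B" by auto
  ultimately show ?thesis by simp
qed

lemma finite_pls:
  assumes pls: "partial_linear_space E \<Lambda>" and fin: "finite E"
  shows "finite \<Lambda>" "finite (point_splittings E \<Lambda>)" "finite (pls_components E \<Lambda>)"
proof -
  have "\<Lambda> \<subseteq> Pow E"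
    using pls_line_subset[OF pls] by blast
  then show \<Lambda>: "finite \<Lambda>"
    using fin finite_subset by blast
  have "point_splittings E \<Lambda> \<subseteq> \<Lambda> \<times> E"
    unfolding point_splittings_def by blast
  then show "finite (point_splittings E \<Lambda>)"
    using \<Lambda> fin finite_subset by blast
  show "finite (pls_components E \<Lambda>)"
    unfolding pls_components_def
    using finite_quotient[OF fin equiv_type[OF equiv_connected_rel]] .
qed

lemma acyclifier_exists:
  assumes pls: "partial_linear_space E \<Lambda>" and fin: "finite E"
  shows "\<exists>A. acyclifier E \<Lambda> A"
proof -
  let ?I = "point_splittings E \<Lambda>"
  obtain F where F: "F \<subseteq> ?I" "graphic.independent F" "?I \<subseteq> graphic_closure F"
    using graphic.finite_has_basis[OF finite_pls(2)[OF assms]] by blast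
  then have "?I - (?I - F) = F" by blast
  then have "acyclifier E \<Lambda> (?I - F)"
    using F unfolding acyclifier_iff_complement_spanning_forest[OF pls finite_pls(3)[OF assms]] by simp
  then show ?thesis ..
qed

text \<open>
  Stated additively to avoid truncated subtraction: the incidence graph has
  \<open>card E + card \<Lambda>\<close> vertices and \<open>\<Sum>l\<in>\<Lambda>. card l\<close> edges, of which \<open>A\<close> leaves out all but a
  spanning forest.
\<close>
proposition card_acyclifier:
  assumes pls: "partial_linear_space E \<Lambda>" and fin: "finite E" and A: "acyclifier E \<Lambda> A"
  shows "card A + card E + card \<Lambda> = num_components E \<Lambda> + (\<Sum>l\<in>\<Lambda>. card l)"
proof -
  let ?I = "point_splittings E \<Lambda>" and ?V = "\<Lambda> <+> E"
  note fins = finite_pls[OF pls fin]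
  have sub: "A \<subseteq> ?I" and indep: "graphic.independent (?I - A)" and span: "?I \<subseteq> graphic_closure (?I - A)"
    using A unfolding acyclifier_iff_complement_spanning_forest[OF pls fins(3)] by auto
  have "card (?I - A) + card (?V // comp_rel ?V (?I - A)) = card ?V"
    using indep fins fin
    by (intro card_forest_plus_components) (auto simp: point_splittings_def)
  moreover have "card (?V // comp_rel ?V (?I - A)) = num_components E \<Lambda>"
    unfolding num_components_def
    using spanning_imp_comp_rel_eq[OF _ span, of ?V] pls_components_eqpoll[OF pls] fins(3)
      eqpoll_finite_iff eqpoll_iff_card by (metis Diff_subset)
  moreover have "card ?V = card \<Lambda> + card E"
    using fins fin by (simp add: card_Plus)
  moreover have "card ?I = (\<Sum>l\<in>\<Lambda>. card l)"
  proof -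
    have "?I = Sigma \<Lambda> (\<lambda>l. l)"
      using pls_line_subset[OF pls] unfolding point_splittings_def by auto
    moreover have "\<forall>l\<in>\<Lambda>. finite l"
      using pls_line_subset[OF pls] fin finite_subset by blast
    ultimately show ?thesis
      using card_SigmaI[OF fins(1)] by simp
  qed
  moreover have "card ?I = card A + card (?I - A)"
    using sub fins(2) by (metis card_Diff_subset card_mono finite_subset le_add_diff_inverse)
  ultimately show ?thesis by linarith
qed

theorem theorem5p1:
  fixes E :: "'a set" and \<Lambda> :: "'a set set"
  assumes "partial_linear_space E \<Lambda>"
  shows "(finite (pls_components E \<Lambda>) \<longrightarrow>
            (\<forall>A B. acyclifier E \<Lambda> A \<and> acyclifier E \<Lambda> B \<longrightarrow> A \<approx> B)) \<and>
         (finite E \<longrightarrow>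
            (\<forall>(t::nat) (l :: nat \<Rightarrow> 'a set). inj_on l {1..t} \<and> \<Lambda> = l ` {1..t} \<longrightarrow>
               int (r_star E \<Lambda>) =
                 int (num_components E \<Lambda>) + (\<Sum>i=1..t. int (card (l i))) - int (card E) - int t))"
proof (intro conjI impI allI)
  fix A B
  assume "finite (pls_components E \<Lambda>)" "acyclifier E \<Lambda> A \<and> acyclifier E \<Lambda> B"
  then show "A \<approx> B"
    using acyclifiers_eqpoll[OF assms] by blast
next
  fix t :: nat and l :: "nat \<Rightarrow> 'a set"
  assume fin: "finite E" and l: "inj_on l {1..t} \<and> \<Lambda> = l ` {1..t}"
  obtain A where A: "acyclifier E \<Lambda> A"
    using acyclifier_exists[OF assms fin] ..
  have "r_star E \<Lambda> = card A"
    unfolding r_star_def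
  proof (rule the_equality)
    show "\<exists>B. acyclifier E \<Lambda> B \<and> card B = card A"
      using A by blast
    show "n = card A" if "\<exists>B. acyclifier E \<Lambda> B \<and> card B = n" for n
      using that card_acyclifier[OF assms fin A] card_acyclifier[OF assms fin] by fastforce
  qed
  moreover have "card \<Lambda> = t" "(\<Sum>l\<in>\<Lambda>. card l) = (\<Sum>i=1..t. card (l i))"
    using l by (auto simp: card_image sum.reindex)
  ultimately have "r_star E \<Lambda> + card E + t = num_components E \<Lambda> + (\<Sum>i=1..t. card (l i))"
    using card_acyclifier[OF assms fin A] by simp
  then have "int (r_star E \<Lambda>) + int (card E) + int t
      = int (num_components E \<Lambda>) + int (\<Sum>i=1..t. card (l i))"
    by linarith
  then show "int (r_star E \<Lambda>) =
      int (num_components E \<Lambda>) + (\<Sum>i=1..t. int (card (l i))) - int (card E) - int t"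
    by simp
qed

end
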